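(* Let $S$ be a finite nonempty set and $p:2^S\to\mathbb{Z}\cup\{-\infty\}$ an integer-valued supermodular function with $p(\emptyset)=0$ and $p(S)>-\infty$ (defining a nonempty integral base-polyhedron). Let $\lambda_1>\dots>\lambda_r$ be the critical values, $\{\hat S_1,\dots,\hat S_r\}$ the principal partition and $\hat C_i=\hat S_1\cup\dots\cup\hat S_i$ the principal chain; let $\beta_1>\dots>\beta_q$ be the essential values, $C_1\subset\dots\subset C_q$ the canonical chain and $\{S_1,\dots,S_q\}$ the canonical partition (all defined in the context). Then: (1) An integer $\beta$ is an essential value if and only if there exists a critical value $\lambda$ with $\beta\ge\lambda>\beta-1$. (2) The essential values $\beta_1>\dots>\beta_q$ are exactly the distinct members of $\lceil\lambda_1\rceil\ge\lceil\lambda_2\rceil\ge\dots\ge\lceil\lambda_r\rceil$. Let $I(j)=\{i:\lceil\lambda_i\rceil=\beta_j\}$ for $j=1,\dots,q$. (3) $S_j=\bigcup_{i\in I(j)}\hat S_i$ for $j=1,\dots,q$. (4) $C_j=\hat C_i$ for $i=\max I(j)$, $j=1,\dots,q$; in particular the canonical chain is a subchain of the principal chain.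
   Context: Supermodular: $p(X)+p(Y)\le p(X\cap Y)+p(X\cup Y)$ whenever both left terms are finite. Principal partition: for real $\lambda$, let $\mathcal{L}(\lambda)$ be the family of all maximizers of $p(X)-\lambda|X|$ over $X\subseteq S$ (a lattice closed under union and intersection). The critical values are the finitely many reals $\lambda$ with $|\mathcal{L}(\lambda)|\ge 2$, listed as $\lambda_1>\dots>\lambda_r$; $\hat S_i$ is the largest member of $\mathcal{L}(\lambda_i)$ minus the smallest member of $\mathcal{L}(\lambda_i)$, and $\hat C_i=\hat S_1\cup\dots\cup\hat S_i$ ($\hat C_0=\emptyset$). Canonical partition (iterative definition): set $C_0=\emptyset$ and for $j=1,2,\dots$ with $C_{j-1}\ne S$ let $\overline{C_{j-1}}=S\setminus C_{j-1}$, $\beta_j=\max\{\lceil (p(X\cup C_{j-1})-p(C_{j-1}))/|X|\rceil : \emptyset\ne X\subseteq\overline{C_{j-1}}\}$, $h_j(X)=p(X\cup C_{j-1})-(\beta_j-1)|X|-p(C_{j-1})$ for $X\subseteq\overline{C_{j-1}}$, $S_j$ = the smallest subset of $\overline{C_{j-1}}$ maximizing $h_j$, and $C_j=C_{j-1}\cup S_j$; $q$ is the index with $C_{q-1}\ne S$ and $C_q=S$. The $\beta_j$ are the essential values, $C_1\subset\dots\subset C_q$ the canonical chain, $\{S_1,\dots,S_q\}$ the canonical partition. *)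

theory Defs
  imports Complex_Main "HOL-Library.Extended_Real"
begin

text \<open>
  Set functions with values in the integers extended by minus infinity are functions
  into \<^typ>\<open>ereal\<close> together with the following restriction on their range.
\<close>

definition integer_valued_on :: "'a set \<Rightarrow> ('a set \<Rightarrow> ereal) \<Rightarrow> bool" where
  "integer_valued_on S p \<longleftrightarrow>
     (\<forall>X\<subseteq>S. p X = -\<infinity> \<or> (\<exists>k::int. p X = ereal (of_int k)))"

definition supermodular_on :: "'a set \<Rightarrow> ('a set \<Rightarrow> ereal) \<Rightarrow> bool" where
  "supermodular_on S p \<longleftrightarrow>
     (\<forall>X\<subseteq>S. \<forall>Y\<subseteq>S. \<bar>p X\<bar> \<noteq> \<infinity> \<longrightarrow> \<bar>p Y\<bar> \<noteq> \<infinity> \<longrightarrow> p X + p Y \<le> p (X \<inter> Y) + p (X \<union> Y))"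


subsection \<open>Principal partition\<close>

definition maximizers :: "'a set \<Rightarrow> ('a set \<Rightarrow> ereal) \<Rightarrow> real \<Rightarrow> 'a set set" where
  "maximizers S p l =
     {X. is_arg_max (\<lambda>X. p X - ereal (l * real (card X))) (\<lambda>X. X \<subseteq> S) X}"

definition critical_values :: "'a set \<Rightarrow> ('a set \<Rightarrow> ereal) \<Rightarrow> real set" where
  "critical_values S p = {l. card (maximizers S p l) \<ge> 2}"

definition num_critical :: "'a set \<Rightarrow> ('a set \<Rightarrow> ereal) \<Rightarrow> nat" where
  "num_critical S p = card (critical_values S p)"

text \<open>
  All families below are indexed from 1, the chains from 0. Here the critical values are
  listed in decreasing order.
\<close>

definition critical_value :: "'a set \<Rightarrow> ('a set \<Rightarrow> ereal) \<Rightarrow> nat \<Rightarrow> real" where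
  "critical_value S p i = rev (sorted_list_of_set (critical_values S p)) ! (i - 1)"

text \<open>
  The order on sets is inclusion, so \<open>LEAST\<close> and \<open>GREATEST\<close> denote the member of a family
  contained in, respectively containing, all the others; these exist for a finite family
  that is closed under union and intersection.
\<close>

definition principal_part :: "'a set \<Rightarrow> ('a set \<Rightarrow> ereal) \<Rightarrow> nat \<Rightarrow> 'a set" where
  "principal_part S p i =
     (GREATEST X. X \<in> maximizers S p (critical_value S p i)) -
     (LEAST X. X \<in> maximizers S p (critical_value S p i))"

definition principal_chain :: "'a set \<Rightarrow> ('a set \<Rightarrow> ereal) \<Rightarrow> nat \<Rightarrow> 'a set" where
  "principal_chain S p i = (\<Union>k\<in>{1..i}. principal_part S p k)"


subsection \<open>Canonical partition\<close>

definition ceiling_ereal :: "ereal \<Rightarrow> ereal" where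
  "ceiling_ereal x = (if \<bar>x\<bar> = \<infinity> then x else ereal (of_int \<lceil>real_of_ereal x\<rceil>))"

text \<open>
  The next three definitions describe one step of the construction, starting from the
  current chain member \<open>C\<close>. The maximum in the first one is a finite number as long as
  \<open>C\<close> is a proper subset of \<open>S\<close> and \<open>p\<close> is finite on \<open>C\<close> and \<open>S\<close>; \<open>THE\<close> only
  converts it to type \<^typ>\<open>int\<close>.
\<close>

definition step_value :: "'a set \<Rightarrow> ('a set \<Rightarrow> ereal) \<Rightarrow> 'a set \<Rightarrow> int" where
  "step_value S p C =
     (THE b. ereal (of_int b) =
        Max {ceiling_ereal ((p (X \<union> C) - p C) / ereal (real (card X))) |X. X \<noteq> {} \<and> X \<subseteq> S - C})"

definition step_function :: "'a set \<Rightarrow> ('a set \<Rightarrow> ereal) \<Rightarrow> 'a set \<Rightarrow> 'a set \<Rightarrow> ereal" where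
  "step_function S p C X =
     p (X \<union> C) - ereal ((of_int (step_value S p C) - 1) * real (card X)) - p C"

definition step_set :: "'a set \<Rightarrow> ('a set \<Rightarrow> ereal) \<Rightarrow> 'a set \<Rightarrow> 'a set" where
  "step_set S p C = (LEAST X. is_arg_max (step_function S p C) (\<lambda>X. X \<subseteq> S - C) X)"

text \<open>
  Once \<open>S\<close> is reached the recursion is stationary, since the only subset of the empty
  complement is the empty set.
\<close>

primrec canonical_chain :: "'a set \<Rightarrow> ('a set \<Rightarrow> ereal) \<Rightarrow> nat \<Rightarrow> 'a set" where
  "canonical_chain S p 0 = {}"
| "canonical_chain S p (Suc j) = canonical_chain S p j \<union> step_set S p (canonical_chain S p j)"

definition canonical_part :: "'a set \<Rightarrow> ('a set \<Rightarrow> ereal) \<Rightarrow> nat \<Rightarrow> 'a set" where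
  "canonical_part S p j = step_set S p (canonical_chain S p (j - 1))"

definition essential_value :: "'a set \<Rightarrow> ('a set \<Rightarrow> ereal) \<Rightarrow> nat \<Rightarrow> int" where
  "essential_value S p j = step_value S p (canonical_chain S p (j - 1))"

definition num_essential :: "'a set \<Rightarrow> ('a set \<Rightarrow> ereal) \<Rightarrow> nat" where
  "num_essential S p = (LEAST q. canonical_chain S p q = S)"

definition essential_values :: "'a set \<Rightarrow> ('a set \<Rightarrow> ereal) \<Rightarrow> int set" where
  "essential_values S p = essential_value S p ` {1..num_essential S p}"

definition critical_indices :: "'a set \<Rightarrow> ('a set \<Rightarrow> ereal) \<Rightarrow> nat \<Rightarrow> nat set" where
  "critical_indices S p j =
     {i \<in> {1..num_critical S p}. \<lceil>critical_value S p i\<rceil> = essential_value S p j}"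

end

theory Submission
  imports Defs
begin

text \<open>
  Write \<open>m(l)\<close> and \<open>M(l)\<close> for the least and the greatest maximizer of \<open>p X - l * card X\<close>.
  Supermodularity gives \<open>M(l) \<subseteq> m(u)\<close> for \<open>u < l\<close>, with equality if there is
  no critical value strictly between \<open>u\<close> and \<open>l\<close>. Hence the principal chain consists of the sets
  \<open>M(\<lambda>\<^sub>i) = m(\<lambda>\<^sub>i\<^sub>+\<^sub>1)\<close>. One step of the canonical construction turns
  \<open>C = m(\<beta>)\<close> into \<open>m(\<beta> - 1)\<close>, where \<open>\<beta>\<close> is the least integer with
  \<open>C = m(\<beta>)\<close>. So the essential values are the integers \<open>\<beta>\<close> with
  \<open>m(\<beta>) \<noteq> m(\<beta> - 1)\<close>, that is, those for which \<open>(\<beta> - 1, \<beta>]\<close> contains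
  a critical value.
\<close>

lemma rev_sorted_list_nth_less:
  fixes A :: "'b::linorder set"
  assumes "finite A" "i < k" "k < card A"
  shows "rev (sorted_list_of_set A) ! k < rev (sorted_list_of_set A) ! i"
proof -
  have "sorted_list_of_set A ! (card A - Suc k) < sorted_list_of_set A ! (card A - Suc i)"
    using strict_sorted_list_of_set[of A] assms
    by (intro sorted_wrt_nth_less[of "(<)"]) auto
  then show ?thesis
    using assms by (simp add: rev_nth)
qed

section \<open>Finite values and the supermodular inequality\<close>

locale integral_supermodular =
  fixes S :: "'a set" and p :: "'a set \<Rightarrow> ereal"
  assumes finite_S: "finite S"
    and integer_valued: "integer_valued_on S p"
    and supermodular: "supermodular_on S p"
    and p_empty: "p {} = 0"
    and p_full: "p S > -\<infinity>"
begin

definition feasible :: "'a set \<Rightarrow> bool" where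
  "feasible X \<longleftrightarrow> X \<subseteq> S \<and> p X \<noteq> -\<infinity>"

text \<open>This real-valued version of \<open>p\<close> allows ordinary real arithmetic. It carries
  information only on feasible sets, since \<open>real_of_ereal\<close> sends -\<infinity> to 0;
  hence the pairing with \<open>feasible\<close> below.\<close>

definition val :: "'a set \<Rightarrow> real" where
  "val X = real_of_ereal (p X)"

text \<open>This is m(l) of the overview. That such a member exists follows only from the lattice
  property of the maximizers.\<close>

definition least_max :: "real \<Rightarrow> 'a set" where
  "least_max l = (LEAST X. X \<in> maximizers S p l)"

definition greatest_max :: "real \<Rightarrow> 'a set" where
  "greatest_max l = (GREATEST X. X \<in> maximizers S p l)"

lemma p_eq_val: "feasible X \<Longrightarrow> p X = ereal (val X)"
  using integer_valued unfolding feasible_def val_def integer_valued_on_def by force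

lemma infeasible: "X \<subseteq> S \<Longrightarrow> \<not> feasible X \<Longrightarrow> p X = -\<infinity>"
  unfolding feasible_def by auto

lemma feasible_subset: "feasible X \<Longrightarrow> X \<subseteq> S"
  unfolding feasible_def by auto

lemma feasible_finite: "feasible X \<Longrightarrow> finite X"
  using finite_S finite_subset feasible_subset by blast

lemma feasible_empty: "feasible {}"
  unfolding feasible_def using p_empty by simp

lemma feasible_full: "feasible S"
  unfolding feasible_def using p_full by auto

lemma finite_feasible: "finite {X. feasible X}"
  by (rule finite_subset[of _ "Pow S"]) (auto simp: feasible_def finite_S)

lemma feasible_Int_Un:
  assumes "feasible X" "feasible Y"
  shows "feasible (X \<inter> Y)" "feasible (X \<union> Y)"
    and "val X + val Y \<le> val (X \<inter> Y) + val (X \<union> Y)"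
proof -
  have sub: "X \<subseteq> S" "Y \<subseteq> S" "X \<inter> Y \<subseteq> S" "X \<union> Y \<subseteq> S"
    using assms feasible_subset by auto
  have le: "p X + p Y \<le> p (X \<inter> Y) + p (X \<union> Y)"
    using supermodular[unfolded supermodular_on_def, rule_format, OF sub(1,2)]
      p_eq_val[OF assms(1)] p_eq_val[OF assms(2)] by simp
  \<comment> \<open>In \<open>ereal\<close> the sum of \<infinity> and -\<infinity> is \<infinity>,
    so a finite lower bound on the sum excludes -\<infinity> from both summands only once
    \<infinity> is ruled out.\<close>
  have not_top: "p (X \<inter> Y) \<noteq> \<infinity>" "p (X \<union> Y) \<noteq> \<infinity>"
    using integer_valued[unfolded integer_valued_on_def, rule_format, OF sub(3)]
      integer_valued[unfolded integer_valued_on_def, rule_format, OF sub(4)] by auto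
  have "p X + p Y \<noteq> -\<infinity>"
    using p_eq_val[OF assms(1)] p_eq_val[OF assms(2)] by simp
  then have "p (X \<inter> Y) \<noteq> -\<infinity>" "p (X \<union> Y) \<noteq> -\<infinity>"
    using le not_top by (cases "p (X \<inter> Y)"; cases "p (X \<union> Y)"; auto)+
  then show feas: "feasible (X \<inter> Y)" "feasible (X \<union> Y)"
    using sub unfolding feasible_def by auto
  show "val X + val Y \<le> val (X \<inter> Y) + val (X \<union> Y)"
    using le assms feas by (simp add: p_eq_val)
qed

section \<open>The lattice of maximizers\<close>

lemma maximizers_iff:
  "X \<in> maximizers S p l \<longleftrightarrow>
     feasible X \<and> (\<forall>Y. feasible Y \<longrightarrow> val Y - l * real (card Y) \<le> val X - l * real (card X))"
  (is "?L \<longleftrightarrow> ?R")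
proof -
  have "?L \<longleftrightarrow> X \<subseteq> S \<and>
      (\<forall>Y\<subseteq>S. p Y - ereal (l * real (card Y)) \<le> p X - ereal (l * real (card X)))"
    unfolding maximizers_def is_arg_max_def by (auto simp: not_less)
  also have "\<dots> \<longleftrightarrow> ?R"
  proof safe
    assume X: "X \<subseteq> S" and
      max: "\<forall>Y\<subseteq>S. p Y - ereal (l * real (card Y)) \<le> p X - ereal (l * real (card X))"
    show feas: "feasible X"
    proof (rule ccontr)
      assume "\<not> feasible X"
      then have "p X = -\<infinity>" using X infeasible by simp
      \<comment> \<open>The empty set has objective value 0 for every \<open>l\<close>, which beats
        -\<infinity>.\<close>
      then show False
        using max[rule_format, of "{}"] p_empty by simp
    qed
    fix Y assume Y: "feasible Y"
    then show "val Y - l * real (card Y) \<le> val X - l * real (card X)"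
      using max[rule_format, OF feasible_subset[OF Y]] feas by (simp add: p_eq_val)
  next
    fix Y assume X: "feasible X" and
      max: "\<forall>Y. feasible Y \<longrightarrow> val Y - l * real (card Y) \<le> val X - l * real (card X)" and "Y \<subseteq> S"
    then show "p Y - ereal (l * real (card Y)) \<le> p X - ereal (l * real (card X))"
      by (cases "feasible Y") (auto simp: p_eq_val infeasible)
  qed (use feasible_subset in auto)
  finally show ?thesis .
qed

lemma maximizersD:
  assumes "X \<in> maximizers S p l"
  shows "feasible X"
    and "feasible Y \<Longrightarrow> val Y - l * real (card Y) \<le> val X - l * real (card X)"
  using assms unfolding maximizers_iff by blast+

lemma finite_maximizers: "finite (maximizers S p l)"
  by (rule finite_subset[OF _ finite_feasible]) (auto simp: maximizers_iff)

lemma maximizers_nonempty: "maximizers S p l \<noteq> {}"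
proof -
  let ?g = "\<lambda>X. val X - l * real (card X)"
  have "Max (?g ` {X. feasible X}) \<in> ?g ` {X. feasible X}"
    using finite_feasible feasible_empty by (intro Max_in) auto
  then obtain X where X: "feasible X" "Max (?g ` {X. feasible X}) = ?g X" by auto
  have "?g Y \<le> ?g X" if "feasible Y" for Y
    unfolding X(2)[symmetric] using finite_feasible that by (intro Max_ge) auto
  then show ?thesis
    using X(1) maximizers_iff by blast
qed

lemma card_Int_Un: "feasible X \<Longrightarrow> feasible Y \<Longrightarrow>
    real (card X) + real (card Y) = real (card (X \<inter> Y)) + real (card (X \<union> Y))"
  using card_Un_Int[of X Y] feasible_finite by (metis add.commute of_nat_add)

text \<open>Cardinality is modular, so the objective inherits supermodularity: the values at
  \<open>X \<inter> Y\<close> and \<open>X \<union> Y\<close> add up to at least twice the maximum,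
  and neither can exceed it.\<close>

lemma maximizers_Int_Un:
  assumes "X \<in> maximizers S p l" "Y \<in> maximizers S p l"
  shows "X \<inter> Y \<in> maximizers S p l" "X \<union> Y \<in> maximizers S p l"
proof -
  have feas: "feasible X" "feasible Y"
    using assms maximizers_iff by auto
  note lat = feasible_Int_Un[OF feas]
  have eq: "l * real (card X) + l * real (card Y) = l * real (card (X \<inter> Y)) + l * real (card (X \<union> Y))"
    using card_Int_Un[OF feas] by (metis distrib_left)
  have max: "val Z - l * real (card Z) \<le> val X - l * real (card X)"
    "val Z - l * real (card Z) \<le> val Y - l * real (card Y)" if "feasible Z" for Z
    using assms that maximizers_iff by auto
  show "X \<inter> Y \<in> maximizers S p l" "X \<union> Y \<in> maximizers S p l"
    unfolding maximizers_iff
    using max lat eq max(1)[OF lat(1)] max(1)[OF lat(2)] by (smt (verit))+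
qed

text \<open>In a finite nonempty family closed under intersection, a minimal member is the least
  one: its intersection with any other member is again a member, hence equal to it.\<close>

lemma least_max:
  shows "least_max l \<in> maximizers S p l"
    and "X \<in> maximizers S p l \<Longrightarrow> least_max l \<subseteq> X"
proof -
  obtain X where X: "X \<in> maximizers S p l"
    and min: "\<And>Y. Y \<in> maximizers S p l \<Longrightarrow> Y \<subseteq> X \<Longrightarrow> Y = X"
    using finite_has_minimal[OF finite_maximizers maximizers_nonempty] by metis
  have "X \<subseteq> Y" if "Y \<in> maximizers S p l" for Y
    using min[OF maximizers_Int_Un(1)[OF X that]] by auto
  then have "least_max l = X"
    unfolding least_max_def using X by (intro Least_equality) auto
  with X \<open>\<And>Y. Y \<in> maximizers S p l \<Longrightarrow> X \<subseteq> Y\<close>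
  show "least_max l \<in> maximizers S p l"
    "X' \<in> maximizers S p l \<Longrightarrow> least_max l \<subseteq> X'" for X'
    by auto
qed

lemma greatest_max:
  shows "greatest_max l \<in> maximizers S p l"
    and "X \<in> maximizers S p l \<Longrightarrow> X \<subseteq> greatest_max l"
proof -
  obtain X where X: "X \<in> maximizers S p l"
    and max: "\<And>Y. Y \<in> maximizers S p l \<Longrightarrow> X \<subseteq> Y \<Longrightarrow> Y = X"
    using finite_has_maximal[OF finite_maximizers maximizers_nonempty] by metis
  have ge: "Y \<subseteq> X" if "Y \<in> maximizers S p l" for Y
    using max[OF maximizers_Int_Un(2)[OF X that]] by auto
  then have "greatest_max l = X"
    unfolding greatest_max_def using X by (intro Greatest_equality) auto
  with X ge show "greatest_max l \<in> maximizers S p l"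
    "X' \<in> maximizers S p l \<Longrightarrow> X' \<subseteq> greatest_max l" for X'
    by auto
qed

lemma least_le_greatest: "least_max l \<subseteq> greatest_max l"
  using least_max(1) greatest_max(2) by blast

lemma feasible_least_max: "feasible (least_max l)"
  using least_max(1) maximizers_iff by blast

section \<open>Dependence of the maximizers on \<open>l\<close>\<close>

text \<open>An exchange argument: compare \<open>X\<close> with \<open>X \<inter> Y\<close> at
  \<open>l\<close>, and \<open>Y\<close> with \<open>X \<union> Y\<close> at \<open>u\<close>.
  Supermodularity links the two comparisons and leaves
  \<open>l * card (X - Y) \<le> u * card (X - Y)\<close>, which forces \<open>X - Y\<close> to be
  empty.\<close>

lemma maximizers_antitone:
  assumes "u < l" "X \<in> maximizers S p l" "Y \<in> maximizers S p u"
  shows "X \<subseteq> Y"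
proof -
  have feas: "feasible X" "feasible Y"
    using assms maximizers_iff by auto
  note lat = feasible_Int_Un[OF feas]
  have fin: "finite X" using feas feasible_finite by auto
  have cX: "real (card X) = card (X \<inter> Y) + card (X - Y)"
    using card_Int_Diff[OF fin, of Y] by simp
  have cU: "real (card (X \<union> Y)) = card Y + card (X - Y)"
    using card_Int_Un[OF feas] cX by simp
  have "val (X \<inter> Y) - l * real (card (X \<inter> Y)) \<le> val X - l * real (card X)"
    using assms(2) lat(1) maximizers_iff by blast
  moreover have "val (X \<union> Y) - u * real (card (X \<union> Y)) \<le> val Y - u * real (card Y)"
    using assms(3) lat(2) maximizers_iff by blast
  ultimately have "l * real (card (X - Y)) \<le> u * real (card (X - Y))"
    using lat(3) unfolding cX cU by (simp add: algebra_simps)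
  then have "card (X - Y) = 0"
    using assms(1) by (simp add: mult_le_cancel_right)
  then show ?thesis
    using fin by simp
qed

lemma greatest_le_least: "u < l \<Longrightarrow> greatest_max l \<subseteq> least_max u"
  using maximizers_antitone greatest_max(1) least_max(1) by blast

lemma least_max_antimono: "u \<le> l \<Longrightarrow> least_max l \<subseteq> least_max u"
  using greatest_le_least[of u l] least_le_greatest[of l] by (cases "u = l") auto

text \<open>All maximizers lie between the least and the greatest one, so there are two different
  ones exactly when these two differ.\<close>

lemma critical_iff: "l \<in> critical_values S p \<longleftrightarrow> least_max l \<noteq> greatest_max l"
proof -
  have "card (maximizers S p l) \<ge> 2 \<longleftrightarrow> (\<exists>X\<in>maximizers S p l. \<exists>Y\<in>maximizers S p l. X \<noteq> Y)"
    using card_le_Suc0_iff_eq[OF finite_maximizers[of l]] by (metis not_less_eq_eq numeral_2_eq_2)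
  also have "\<dots> \<longleftrightarrow> least_max l \<noteq> greatest_max l"
    using least_max[where l = l] greatest_max[where l = l] by (metis subset_antisym)
  finally show ?thesis
    unfolding critical_values_def by simp
qed

text \<open>
  Between \<open>l\<close> and \<open>u\<close> the objective of \<open>A = greatest_max l\<close> is first overtaken by a
  larger set at the steepest slope \<open>(val Y - val A) / \<bar>Y - A\<bar>\<close>, which is
  then a critical value.
\<close>

lemma greatest_eq_least:
  assumes ul: "u < l" and no_crit: "\<And>c. c \<in> critical_values S p \<Longrightarrow> u < c \<Longrightarrow> \<not> c < l"
  shows "greatest_max l = least_max u"
proof (rule ccontr)
  define A where "A = greatest_max l"
  \<comment> \<open>For \<open>Y\<close> properly containing \<open>A\<close>, this is the parameter
    at which \<open>Y\<close> and \<open>A\<close> have equal objective values.\<close>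
  define slope where "slope Y = (val Y - val A) / card (Y - A)" for Y
  define F where "F = {Y. feasible Y \<and> A \<subset> Y}"
  assume "greatest_max l \<noteq> least_max u"
  then have B: "least_max u \<in> F"
    using greatest_le_least[OF ul] feasible_least_max unfolding F_def A_def by auto
  have A: "feasible A" "A \<in> maximizers S p l"
    using greatest_max(1)[of l] maximizers_iff unfolding A_def by auto
  have fin: "finite F"
    by (rule finite_subset[OF _ finite_feasible]) (auto simp: F_def)
  have card_F: "card Y = real (card A) + card (Y - A) \<and> card (Y - A) > 0" if "Y \<in> F" for Y
  proof -
    have "finite Y" "A \<subset> Y" using that feasible_finite unfolding F_def by auto
    then show ?thesis
      using card_Diff_subset[of A Y] psubset_card_mono[of Y A] finite_subset[of A Y]
      by (simp add: psubset_imp_subset of_nat_diff)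
  qed
  define c where "c = Max (slope ` F)"
  have "c \<in> slope ` F"
    unfolding c_def using fin B by (intro Max_in) auto
  then obtain Y where Y: "Y \<in> F" "c = slope Y" by auto
  have slope_le: "slope Z \<le> c" if "Z \<in> F" for Z
    unfolding c_def using fin that by simp
  \<comment> \<open>\<open>A\<close> is the greatest maximizer at \<open>l\<close>, so the strictly
    larger \<open>Y\<close> is strictly worse there.\<close>
  have "c < l"
  proof -
    have "Y \<notin> maximizers S p l"
      using greatest_max(2)[of Y l] Y(1) unfolding F_def A_def by auto
    then have "val Y - l * real (card Y) < val A - l * real (card A)"
      using A(2) Y(1) unfolding maximizers_iff F_def by (smt (verit) mem_Collect_eq)
    then show ?thesis
      using card_F[OF Y(1)] unfolding Y(2) slope_def
      by (simp add: pos_divide_less_eq algebra_simps)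
  qed
  \<comment> \<open>The least maximizer at \<open>u\<close> properly contains \<open>A\<close>, so
    it strictly beats \<open>A\<close> at \<open>u\<close> and its slope exceeds
    \<open>u\<close>.\<close>
  moreover have "u < c"
  proof -
    have "A \<notin> maximizers S p u"
      using least_max(2)[of A u] B unfolding F_def by auto
    then have "val A - u * real (card A) < val (least_max u) - u * real (card (least_max u))"
      using A(1) least_max(1)[of u] unfolding maximizers_iff by (smt (verit))
    then have "u < slope (least_max u)"
      using card_F[OF B] unfolding slope_def
      by (simp add: pos_less_divide_eq algebra_simps)
    then show ?thesis
      using slope_le[OF B] by simp
  qed
  moreover have "c \<in> critical_values S p"
  proof -
    have "val Z - c * real (card Z) \<le> val A - c * real (card A)" if "feasible Z" "A \<subseteq> Z" for Z
    proof (cases "Z = A")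
      case False
      then have Z: "Z \<in> F" using that unfolding F_def by auto
      show ?thesis
        using slope_le[OF Z] card_F[OF Z] unfolding slope_def
        by (simp add: pos_divide_le_eq algebra_simps)
    qed simp
    \<comment> \<open>Optimality of \<open>A\<close> at \<open>c\<close> has been checked only
      against supersets; this suffices because some maximizer at \<open>c\<close> is a superset of
      \<open>A\<close>.\<close>
    moreover have "A \<subseteq> least_max c"
      unfolding A_def using \<open>c < l\<close> by (rule greatest_le_least)
    ultimately have "val (least_max c) - c * real (card (least_max c)) \<le> val A - c * real (card A)"
      using feasible_least_max by blast
    then have maxA: "A \<in> maximizers S p c"
      using least_max(1)[of c] A(1) unfolding maximizers_iff by (smt (verit))
    have "val Y - c * real (card Y) = val A - c * real (card A)"
      using card_F[OF Y(1)] unfolding Y(2) slope_def by (simp add: field_simps)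
    then have "Y \<in> maximizers S p c"
      using maxA Y(1) unfolding maximizers_iff F_def by simp
    then have "Y \<subseteq> greatest_max c" "least_max c \<subseteq> A"
      using maxA least_max(2) greatest_max(2) by auto
    then show ?thesis
      using Y(1) unfolding critical_iff F_def by auto
  qed
  ultimately show False
    using no_crit by blast
qed

section \<open>Large parameters and finiteness of the critical values\<close>

lemma val_bound: obtains K :: int where "K > 0" "\<And>X. feasible X \<Longrightarrow> \<bar>val X\<bar> < of_int K"
proof -
  define K where "K = \<lceil>Max ((\<lambda>X. \<bar>val X\<bar>) ` {X. feasible X})\<rceil> + 1"
  have "\<bar>val X\<bar> < of_int K" if "feasible X" for X
  proof -
    have "\<bar>val X\<bar> \<le> Max ((\<lambda>X. \<bar>val X\<bar>) ` {X. feasible X})"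
      using that finite_feasible by (intro Max_ge) auto
    then show ?thesis unfolding K_def by linarith
  qed
  moreover from this[OF feasible_empty] have "K > 0" by linarith
  ultimately show ?thesis using that by blast
qed

text \<open>Once the parameter exceeds a bound on all finite values of \<open>p\<close>, a single
  element costs more than any set can gain. This gives the starting point of both chains.\<close>

lemma ex_greatest_max_empty:
  fixes b :: real
  shows "\<exists>k::int. of_int k > b \<and> greatest_max (of_int k) = {}"
proof -
  obtain K where K: "K > 0" "\<And>X. feasible X \<Longrightarrow> \<bar>val X\<bar> < of_int K"
    using val_bound by blast
  define k where "k = max K (\<lceil>b\<rceil> + 1)"
  let ?X = "greatest_max (of_int k)"
  have max: "feasible ?X" "val {} - of_int k * real (card ({}::'a set)) \<le> val ?X - of_int k * real (card ?X)"
    using maximizersD[OF greatest_max(1)] feasible_empty by blast+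
  have "val {} = 0" unfolding val_def p_empty by simp
  then have "of_int k * real (card ?X) < of_int K"
    using max K(2)[OF max(1)] by simp
  moreover have "of_int K \<le> (of_int k :: real)" unfolding k_def by simp
  ultimately have "of_int k * real (card ?X) < of_int k * 1" by linarith
  then have "real (card ?X) < 1"
    using K(1) unfolding k_def by (subst (asm) mult_less_cancel_left_pos) auto
  then have "?X = {}" using feasible_finite[OF max(1)] by simp
  moreover have "of_int k > b" unfolding k_def by linarith
  ultimately show ?thesis by blast
qed

lemma least_max_eq_empty:
  assumes "\<And>c. c \<in> critical_values S p \<Longrightarrow> c \<le> u"
  shows "least_max u = {}"
proof -
  obtain k :: int where "of_int k > u" "greatest_max (of_int k) = {}"
    using ex_greatest_max_empty by blast
  then show ?thesis
    using greatest_eq_least[of u "of_int k"] assms by force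
qed

text \<open>Passing down to a critical value \<open>u\<close> strictly enlarges the greatest
  maximizer, since M(l) is contained in m(u), a proper subset of M(u). So different critical values
  yield different subsets of \<open>S\<close>.\<close>

lemma finite_critical: "finite (critical_values S p)"
proof (rule inj_on_finite[where f = greatest_max and B = "Pow S"])
  show "inj_on greatest_max (critical_values S p)"
  proof (rule linorder_inj_onI)
    fix u l assume "u < l" "u \<in> critical_values S p"
    then show "greatest_max u \<noteq> greatest_max l"
      using greatest_le_least[of u l] least_le_greatest[of u] unfolding critical_iff by auto
  qed auto
  show "greatest_max ` critical_values S p \<subseteq> Pow S"
    using greatest_max(1) feasible_subset maximizers_iff by blast
qed (simp add: finite_S)

text \<open>The interval is half-open because m is compared at both ends: a critical value at
  \<open>b\<close> separates m(b) from M(b), which lies in m(b - 1), whereas one at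
  \<open>b - 1\<close> affects only M(b - 1).\<close>

lemma least_max_neq_iff:
  "least_max (of_int b) \<noteq> least_max (of_int b - 1) \<longleftrightarrow>
     (\<exists>l\<in>critical_values S p. of_int b \<ge> l \<and> l > of_int b - 1)"
  for b :: int
proof
  assume neq: "least_max (of_int b) \<noteq> least_max (of_int b - 1)"
  show "\<exists>l\<in>critical_values S p. of_int b \<ge> l \<and> l > of_int b - 1"
  proof (rule ccontr)
    assume none: "\<not> ?thesis"
    then have "least_max (of_int b) = greatest_max (of_int b)"
      using critical_iff by force
    moreover have "greatest_max (of_int b) = least_max (of_int b - 1)"
      using none by (intro greatest_eq_least) force+
    ultimately show False using neq by simp
  qed
next
  assume "\<exists>l\<in>critical_values S p. of_int b \<ge> l \<and> l > of_int b - 1"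
  then obtain l where l: "l \<in> critical_values S p" "of_int b \<ge> l" "l > of_int b - 1" by blast
  have "least_max (of_int b) \<subseteq> least_max l" "greatest_max l \<subseteq> least_max (of_int b - 1)"
    using l least_max_antimono greatest_le_least by auto
  then show "least_max (of_int b) \<noteq> least_max (of_int b - 1)"
    using l(1) least_le_greatest[of l] unfolding critical_iff by auto
qed

subsection \<open>The principal chain\<close>

lemma critical_value_less:
  "1 \<le> i \<Longrightarrow> i < k \<Longrightarrow> k \<le> num_critical S p \<Longrightarrow> critical_value S p k < critical_value S p i"
  unfolding critical_value_def num_critical_def
  by (intro rev_sorted_list_nth_less finite_critical) auto

lemma critical_value_le:
  "1 \<le> i \<Longrightarrow> i \<le> k \<Longrightarrow> k \<le> num_critical S p \<Longrightarrow> critical_value S p k \<le> critical_value S p i"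
  using critical_value_less[of i k] by (cases "i = k") auto

lemma critical_values_eq: "critical_values S p = critical_value S p ` {1..num_critical S p}"
proof -
  let ?xs = "rev (sorted_list_of_set (critical_values S p))"
  have "critical_values S p = set ?xs"
    using finite_critical by simp
  also have "\<dots> = (!) ?xs ` {0..<length ?xs}"
    by (metis list.set_map map_nth set_upt)
  also have "length ?xs = num_critical S p"
    by (simp add: num_critical_def)
  \<comment> \<open>The shift by \<open>Suc\<close> passes from list positions, counted from 0, to
    critical values, counted from 1.\<close>
  also have "(!) ?xs ` {0..<num_critical S p} = critical_value S p ` Suc ` {0..<num_critical S p}"
    unfolding image_image critical_value_def by simp
  also have "Suc ` {0..<num_critical S p} = {1..num_critical S p}"
    by (simp add: image_Suc_atLeastLessThan atLeastLessThanSuc_atLeastAtMost)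
  finally show ?thesis .
qed

lemma principal_part_eq:
  "principal_part S p i = greatest_max (critical_value S p i) - least_max (critical_value S p i)"
  unfolding principal_part_def greatest_max_def least_max_def by simp

lemma least_max_first:
  assumes "1 \<le> num_critical S p"
  shows "least_max (critical_value S p 1) = {}"
  using assms critical_value_le by (intro least_max_eq_empty) (auto simp: critical_values_eq)

lemma least_max_Suc:
  assumes "1 \<le> i" "Suc i \<le> num_critical S p"
  shows "greatest_max (critical_value S p i) = least_max (critical_value S p (Suc i))"
proof (rule greatest_eq_least)
  show "critical_value S p (Suc i) < critical_value S p i"
    using assms by (intro critical_value_less) auto
  fix c assume "c \<in> critical_values S p" and gt: "critical_value S p (Suc i) < c"
  then obtain k where k: "1 \<le> k" "k \<le> num_critical S p" "c = critical_value S p k"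
    unfolding critical_values_eq by auto
  have "k \<le> i"
    using gt k critical_value_le[of "Suc i" k] by force
  then show "\<not> c < critical_value S p i"
    using critical_value_le[of k i] k assms by simp
qed

text \<open>The differences telescope: the first one starts at the empty set, and each later one
  starts where its predecessor ended.\<close>

lemma principal_chain_eq:
  assumes "1 \<le> i" "i \<le> num_critical S p"
  shows "principal_chain S p i = greatest_max (critical_value S p i)"
  using assms
proof (induction i rule: nat_induct_at_least)
  case base
  then show ?case
    using least_max_first unfolding principal_chain_def by (simp add: principal_part_eq)
next
  case (Suc i)
  have "principal_chain S p (Suc i) = principal_chain S p i \<union> principal_part S p (Suc i)"
    unfolding principal_chain_def by (simp add: atLeastAtMostSuc_conv Un_commute)
  also have "\<dots> = greatest_max (critical_value S p (Suc i))"
    using Suc least_max_Suc[of i] least_le_greatest by (auto simp: principal_part_eq)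
  finally show ?case .
qed

subsection \<open>The canonical chain\<close>

lemma card_Un_complement:
  assumes "feasible C" "X \<subseteq> S - C"
  shows "real (card (X \<union> C)) = real (card X) + real (card C)"
proof -
  have "X \<inter> C = {}" using assms(2) by auto
  moreover have "finite X" using assms(2) finite_S by (auto intro: finite_subset)
  ultimately show ?thesis
    using assms(1) feasible_finite by (simp add: card_Un_disjoint)
qed

text \<open>The two parts together characterize the step value as the least integer \<open>b\<close>
  such that every increment over \<open>C\<close> is at most \<open>b * card X\<close>. The second
  part is the failure of \<open>b - 1\<close>.\<close>

lemma step_value:
  assumes C: "feasible C" "C \<noteq> S"
  shows "\<And>X. X \<subseteq> S - C \<Longrightarrow> feasible (X \<union> C) \<Longrightarrow>
      val (X \<union> C) - val C \<le> of_int (step_value S p C) * real (card X)"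
    and "\<exists>X. X \<noteq> {} \<and> X \<subseteq> S - C \<and> feasible (X \<union> C) \<and>
      val (X \<union> C) - val C > (of_int (step_value S p C) - 1) * real (card X)"
proof -
  define G where "G X = ceiling_ereal ((p (X \<union> C) - p C) / ereal (real (card X)))" for X
  define F where "F = {X. X \<noteq> {} \<and> X \<subseteq> S - C}"
  have F: "{ceiling_ereal ((p (X \<union> C) - p C) / ereal (real (card X))) |X.
      X \<noteq> {} \<and> X \<subseteq> S - C} = G ` F"
    unfolding F_def G_def by auto
  have fin: "finite F"
    by (rule finite_subset[of _ "Pow S"]) (auto simp: F_def finite_S)
  have sub: "C \<subseteq> S" using C feasible_subset by blast
  have cardF: "card X > 0" "X \<union> C \<subseteq> S" if "X \<in> F" for X
    using that sub finite_S unfolding F_def by (auto simp: card_gt_0_iff intro: finite_subset)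
  have G1: "G X = ereal (of_int \<lceil>(val (X \<union> C) - val C) / card X\<rceil>)"
    if "X \<in> F" "feasible (X \<union> C)" for X
    using that C cardF(1)[OF that(1)] unfolding G_def ceiling_ereal_def by (simp add: p_eq_val)
  have G2: "G X = -\<infinity>" if "X \<in> F" "\<not> feasible (X \<union> C)" for X
    using that C cardF[OF that(1)] unfolding G_def ceiling_ereal_def
    by (simp add: p_eq_val infeasible)
  \<comment> \<open>The set \<open>S - C\<close> gives a finite quotient, so the maximum is not
    -\<infinity> and is attained at a set \<open>Y\<close> with \<open>Y \<union> C\<close>
    feasible.\<close>
  have full: "S - C \<in> F" "feasible ((S - C) \<union> C)"
    using sub C feasible_full unfolding F_def by (auto simp: Un_absorb2)
  have "Max (G ` F) \<in> G ` F"
    using fin full by (intro Max_in) auto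
  then obtain Y where Y: "Y \<in> F" "Max (G ` F) = G Y" by auto
  have G_le: "G X \<le> G Y" if "X \<in> F" for X
    unfolding Y(2)[symmetric] using fin that by simp
  have feasY: "feasible (Y \<union> C)"
    using G_le[OF full(1)] G1[OF full] G2[OF Y(1)] ereal_infty_less_eq(2) MInfty_neq_ereal(1)
    by metis
  define k where "k = \<lceil>(val (Y \<union> C) - val C) / card Y\<rceil>"
  have GY: "G Y = ereal (of_int k)"
    unfolding k_def using G1[OF Y(1) feasY] .
  have k: "step_value S p C = k"
    unfolding step_value_def F Y(2) GY by (rule the_equality) auto
  show "val (X \<union> C) - val C \<le> of_int (step_value S p C) * real (card X)"
    if X: "X \<subseteq> S - C" "feasible (X \<union> C)" for X
  proof (cases "X = {}")
    case False
    then have XF: "X \<in> F" using X unfolding F_def by auto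
    have "\<lceil>(val (X \<union> C) - val C) / card X\<rceil> \<le> k"
      using G_le[OF XF] G1[OF XF X(2)] GY by simp
    then have "(val (X \<union> C) - val C) / card X \<le> of_int k" by linarith
    then show ?thesis
      unfolding k using cardF(1)[OF XF] by (simp add: pos_divide_le_eq)
  qed simp
  have "(val (Y \<union> C) - val C) / card Y > of_int k - 1"
    unfolding k_def by linarith
  then have "val (Y \<union> C) - val C > (of_int k - 1) * real (card Y)"
    using cardF(1)[OF Y(1)] by (simp add: pos_less_divide_eq)
  then show "\<exists>X. X \<noteq> {} \<and> X \<subseteq> S - C \<and> feasible (X \<union> C) \<and>
      val (X \<union> C) - val C > (of_int (step_value S p C) - 1) * real (card X)"
    using Y(1) feasY unfolding k F_def by blast
qed

text \<open>Up to a constant depending on \<open>C\<close>, the step function is the objective for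
  the parameter \<open>b - 1\<close> at \<open>X \<union> C\<close>. Hypothesis \<open>below\<close>
  ensures that restricting to supersets of \<open>C\<close> does not lower the maximum.\<close>

lemma step_arg_max_iff:
  assumes C: "feasible C" and below: "C \<subseteq> least_max (of_int (step_value S p C) - 1)"
  shows "is_arg_max (step_function S p C) (\<lambda>X. X \<subseteq> S - C) X \<longleftrightarrow>
    X \<subseteq> S - C \<and> X \<union> C \<in> maximizers S p (of_int (step_value S p C) - 1)"
    (is "?L \<longleftrightarrow> _ \<and> _ \<in> maximizers S p ?b")
proof -
  have sub: "C \<subseteq> S" using C feasible_subset by blast
  note card = card_Un_complement[OF C]
  have fin: "step_function S p C X =
      ereal (val (X \<union> C) - ?b * real (card (X \<union> C)) - (val C - ?b * real (card C)))"
    if "X \<subseteq> S - C" "feasible (X \<union> C)" for X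
    using that C card[OF that(1)] unfolding step_function_def
    by (simp add: p_eq_val algebra_simps)
  have inf: "step_function S p C X = -\<infinity>"
    if "X \<subseteq> S - C" "\<not> feasible (X \<union> C)" for X
  proof -
    have "X \<union> C \<subseteq> S" using that sub by auto
    then show ?thesis
      using that C unfolding step_function_def by (simp add: p_eq_val infeasible)
  qed
  have L: "?L \<longleftrightarrow> X \<subseteq> S - C \<and> (\<forall>Y\<subseteq>S - C. step_function S p C Y \<le> step_function S p C X)"
    unfolding is_arg_max_def by (auto simp: not_less)
  show ?thesis
  proof safe
    assume ?L
    then have X: "X \<subseteq> S - C"
      and max: "\<And>Y. Y \<subseteq> S - C \<Longrightarrow> step_function S p C Y \<le> step_function S p C X"
      unfolding L by auto
    then show "x \<in> S" "x \<in> C \<Longrightarrow> False" if "x \<in> X" for x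
      using that by auto
    \<comment> \<open>This competitor attains the global maximum within the restricted
      problem.\<close>
    let ?Y = "least_max ?b - C"
    have Y: "?Y \<subseteq> S - C" "?Y \<union> C = least_max ?b"
      using below feasible_subset[OF feasible_least_max] by auto
    have "feasible (X \<union> C)"
      using max[OF Y(1)] fin[OF Y(1)] inf[OF X] Y(2) feasible_least_max by fastforce
    then show "X \<union> C \<in> maximizers S p ?b"
      using max[OF Y(1)] fin[OF Y(1)] fin[OF X] least_max(1)[of ?b]
      unfolding Y(2) maximizers_iff by fastforce
  next
    assume X: "X \<subseteq> S - C" and max: "X \<union> C \<in> maximizers S p ?b"
    have "step_function S p C Y \<le> step_function S p C X" if "Y \<subseteq> S - C" for Y
      using that X max fin inf unfolding maximizers_iff
      by (cases "feasible (Y \<union> C)") auto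
    then show ?L unfolding L using X by simp
  qed
qed

text \<open>No increment exceeds rate \<open>b\<close>, so \<open>C\<close> is best among its
  supersets at \<open>b\<close>; as m(b) is such a superset, m(b) is \<open>C\<close>. Some
  increment exceeds rate \<open>b - 1\<close>, so \<open>C\<close> is not optimal at
  \<open>b - 1\<close> and the step is proper. The same increment, compared with optimality of
  \<open>C\<close> at \<open>k\<close>, gives \<open>b \<le> k\<close>.\<close>

lemma canonical_step:
  fixes k :: int
  assumes C: "C = least_max (of_int k)" "C \<noteq> S"
  defines "b \<equiv> step_value S p C"
  shows "b \<le> k" "least_max (of_int b) = C"
    "least_max (of_int b - 1) = C \<union> step_set S p C" "C \<inter> step_set S p C = {}"
    "C \<subset> C \<union> step_set S p C" "C \<union> step_set S p C \<subseteq> S"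
proof -
  have feas: "feasible C" and sub: "C \<subseteq> S"
    using C feasible_least_max feasible_subset by auto
  note card = card_Un_complement[OF feas]
  obtain X where X: "X \<noteq> {}" "X \<subseteq> S - C" "feasible (X \<union> C)"
    "val (X \<union> C) - val C > (of_int b - 1) * real (card X)"
    using step_value(2)[OF feas C(2)] unfolding b_def by blast
  have cardX: "card X > 0"
    using X finite_S by (auto simp: card_gt_0_iff intro: finite_subset)
  have "val (X \<union> C) - of_int k * real (card (X \<union> C)) \<le> val C - of_int k * real (card C)"
    unfolding C(1) using X(3)[unfolded C(1)] by (rule maximizersD(2)[OF least_max(1)])
  then have "val (X \<union> C) - val C \<le> of_int k * real (card X)"
    using card[OF X(2)] by (simp add: algebra_simps)
  then have "(of_int b - 1) * real (card X) < of_int k * real (card X)"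
    using X(4) by linarith
  then have "of_int b - 1 < (of_int k :: real)"
    using cardX by simp
  then show bk: "b \<le> k" by linarith
  have Cb: "C \<subseteq> least_max (of_int b)"
    unfolding C(1) using bk by (intro least_max_antimono) simp
  define Y where "Y = least_max (of_int b) - C"
  have Y: "Y \<subseteq> S - C" "Y \<union> C = least_max (of_int b)"
    using Cb feasible_subset[OF feasible_least_max] unfolding Y_def by auto
  have "val (Y \<union> C) - val C \<le> of_int b * real (card Y)"
    unfolding b_def using feas C(2) Y(1) feasible_least_max Y(2)
    by (intro step_value(1)) auto
  then have "val (Y \<union> C) - of_int b * real (card (Y \<union> C)) \<le> val C - of_int b * real (card C)"
    using card[OF Y(1)] by (simp add: algebra_simps)
  then have "C \<in> maximizers S p (of_int b)"
    using feas least_max(1)[of "of_int b"] unfolding Y(2) maximizers_iff by (smt (verit))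
  then show Cb': "least_max (of_int b) = C"
    using Cb least_max(2) by blast
  have below: "C \<subseteq> least_max (of_int b - 1)"
    using least_max_antimono[of "of_int b - 1" "of_int b"] Cb' by simp
  have step: "step_set S p C = least_max (of_int b - 1) - C"
    unfolding step_set_def step_arg_max_iff[OF feas below[unfolded b_def]] b_def[symmetric]
  proof (rule Least_equality)
    have "least_max (of_int b - 1) - C \<union> C = least_max (of_int b - 1)"
      using below by auto
    then show "least_max (of_int b - 1) - C \<subseteq> S - C \<and>
        least_max (of_int b - 1) - C \<union> C \<in> maximizers S p (of_int b - 1)"
      using least_max(1) feasible_subset[OF feasible_least_max] by auto
  next
    fix Z assume "Z \<subseteq> S - C \<and> Z \<union> C \<in> maximizers S p (of_int b - 1)"
    then show "least_max (of_int b - 1) - C \<le> Z"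
      using least_max(2)[of "Z \<union> C"] by auto
  qed
  then show eq: "least_max (of_int b - 1) = C \<union> step_set S p C" "C \<inter> step_set S p C = {}"
    using below by auto
  have "C \<notin> maximizers S p (of_int b - 1)"
  proof
    assume "C \<in> maximizers S p (of_int b - 1)"
    then have "val (X \<union> C) - (of_int b - 1) * real (card (X \<union> C)) \<le> val C - (of_int b - 1) * real (card C)"
      using X(3) by (rule maximizersD(2))
    then show False
      using X(4) card[OF X(2)] by (simp add: algebra_simps)
  qed
  then have "C \<noteq> least_max (of_int b - 1)"
    using least_max(1) by metis
  then show "C \<subset> C \<union> step_set S p C"
    unfolding eq(1) using below by auto
  show "C \<union> step_set S p C \<subseteq> S"
    unfolding eq(1)[symmetric] using feasible_subset[OF feasible_least_max] .
qed

text \<open>Supplies the integer \<open>k\<close> needed by \<open>canonical_step\<close>. The form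
  m(k) persists since a step with value \<open>b\<close> ends at m(b - 1); the hypothesis keeps
  every step away from \<open>C = S\<close>.\<close>

lemma canonical_chain_least_max:
  assumes "\<And>i. i < j \<Longrightarrow> canonical_chain S p i \<noteq> S"
  shows "\<exists>k::int. canonical_chain S p j = least_max (of_int k)"
  using assms
proof (induction j)
  case 0
  obtain k :: int where "greatest_max (of_int k) = {}"
    using ex_greatest_max_empty by blast
  then have "least_max (of_int k) = {}"
    using least_le_greatest[of "of_int k"] by auto
  then show ?case by auto
next
  case (Suc j)
  then obtain k :: int where k: "canonical_chain S p j = least_max (of_int k)"
    using less_SucI by blast
  let ?b = "step_value S p (canonical_chain S p j)"
  have "canonical_chain S p (Suc j) = least_max (of_int (?b - 1))"
    using canonical_step(3)[OF k] Suc.prems by simp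
  then show ?case by blast
qed

text \<open>Otherwise the chain would increase strictly forever inside the finite set
  \<open>S\<close>.\<close>

lemma canonical_chain_reaches_full: "\<exists>j. canonical_chain S p j = S"
proof (rule ccontr)
  assume "\<not> ?thesis"
  then have neq: "canonical_chain S p j \<noteq> S" for j by blast
  have sub: "canonical_chain S p j \<subset> canonical_chain S p (Suc j)"
    "canonical_chain S p (Suc j) \<subseteq> S" for j
  proof -
    obtain k :: int where "canonical_chain S p j = least_max (of_int k)"
      using canonical_chain_least_max neq by blast
    from canonical_step(5,6)[OF this neq]
    show "canonical_chain S p j \<subset> canonical_chain S p (Suc j)"
      "canonical_chain S p (Suc j) \<subseteq> S" by auto
  qed
  have "j \<le> card (canonical_chain S p j)" for j
  proof (induction j)
    case (Suc j)
    have "card (canonical_chain S p j) < card (canonical_chain S p (Suc j))"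
      using sub finite_S by (meson finite_subset psubset_card_mono)
    then show ?case using Suc by linarith
  qed simp
  from this[of "Suc (card S)"] show False
    using card_mono[OF finite_S sub(2)[of "card S"]] by linarith
qed

lemma canonical_chain_num_essential: "canonical_chain S p (num_essential S p) = S"
  unfolding num_essential_def using canonical_chain_reaches_full by (rule LeastI_ex)

lemma canonical_chain_neq: "j < num_essential S p \<Longrightarrow> canonical_chain S p j \<noteq> S"
  unfolding num_essential_def by (rule not_less_Least)

lemma essential_value:
  assumes "1 \<le> j" "j \<le> num_essential S p"
  shows "least_max (of_int (essential_value S p j)) = canonical_chain S p (j - 1)"
    and "least_max (of_int (essential_value S p j) - 1) = canonical_chain S p j"
    and "canonical_part S p j = canonical_chain S p j - canonical_chain S p (j - 1)"
    and "canonical_chain S p (j - 1) \<subset> canonical_chain S p j"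
    and "canonical_chain S p (j - 1) = least_max (of_int k) \<Longrightarrow> essential_value S p j \<le> k"
proof -
  have neq: "canonical_chain S p (j - 1) \<noteq> S"
    using assms by (intro canonical_chain_neq) auto
  have Suc: "canonical_chain S p j =
      canonical_chain S p (j - 1) \<union> step_set S p (canonical_chain S p (j - 1))"
    using assms(1) by (cases j) auto
  have "\<exists>k::int. canonical_chain S p (j - 1) = least_max (of_int k)"
    using assms by (intro canonical_chain_least_max canonical_chain_neq) auto
  then obtain k0 :: int where k0: "canonical_chain S p (j - 1) = least_max (of_int k0)" by blast
  note step = canonical_step[OF k0 neq]
  show "least_max (of_int (essential_value S p j)) = canonical_chain S p (j - 1)"
    "least_max (of_int (essential_value S p j) - 1) = canonical_chain S p j"
    "canonical_part S p j = canonical_chain S p j - canonical_chain S p (j - 1)"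
    "canonical_chain S p (j - 1) \<subset> canonical_chain S p j"
    using step(2-5) unfolding Suc essential_value_def canonical_part_def by auto
  show "essential_value S p j \<le> k" if "canonical_chain S p (j - 1) = least_max (of_int k)"
    using canonical_step(1)[OF that neq] unfolding essential_value_def .
qed

section \<open>Characterization of the essential values\<close>

lemma essential_value_less:
  assumes "1 \<le> j" "j < k" "k \<le> num_essential S p"
  shows "essential_value S p k < essential_value S p j"
proof -
  have Suc: "essential_value S p (Suc i) < essential_value S p i"
    if "1 \<le> i" "i < num_essential S p" for i
  proof -
    \<comment> \<open>The chain member ending step \<open>i\<close> is m at the essential value
      minus 1, so minimality of the next essential value makes it smaller by at least 1.\<close>
    have "canonical_chain S p (Suc i - 1) = least_max (of_int (essential_value S p i - 1))"
      using essential_value(2)[of i] that by simp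
    then have "essential_value S p (Suc i) \<le> essential_value S p i - 1"
      using that by (intro essential_value(5)) auto
    then show ?thesis by simp
  qed
  have "j \<le> n \<Longrightarrow> n < num_essential S p \<Longrightarrow>
      essential_value S p (Suc n) < essential_value S p j" for n
  proof (induction n rule: dec_induct)
    case base
    then show ?case using Suc assms(1) by simp
  next
    case (step n)
    then show ?case using Suc[of "Suc n"] assms(1) by simp
  qed
  from this[of "k - 1"] show ?thesis using assms by simp
qed

lemma mem_essential_values_iff:
  "b \<in> essential_values S p \<longleftrightarrow> least_max (of_int b) \<noteq> least_max (of_int b - 1)"
proof
  assume "b \<in> essential_values S p"
  then obtain j where "1 \<le> j" "j \<le> num_essential S p" "b = essential_value S p j"
    unfolding essential_values_def by auto
  then show "least_max (of_int b) \<noteq> least_max (of_int b - 1)"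
    using essential_value(1,2,4)[of j] by auto
next
  assume neq: "least_max (of_int b) \<noteq> least_max (of_int b - 1)"
  \<comment> \<open>The first index at which the chain covers m(b - 1). A value \<open>b\<close>
    above \<open>?e\<close> would put m(b - 1) inside the previous chain member, against minimality;
    one below would put it inside m(b), against \<open>neq\<close>.\<close>
  define j where "j = (LEAST j. least_max (of_int b - 1) \<subseteq> canonical_chain S p j)"
  have full: "least_max (of_int b - 1) \<subseteq> canonical_chain S p (num_essential S p)"
    unfolding canonical_chain_num_essential by (rule feasible_subset[OF feasible_least_max])
  have sub: "least_max (of_int b - 1) \<subseteq> canonical_chain S p j"
    unfolding j_def using full by (rule LeastI)
  have jq: "j \<le> num_essential S p"
    unfolding j_def using full by (rule Least_le)
  have mono: "least_max (of_int b) \<subseteq> least_max (of_int b - 1)"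
    by (rule least_max_antimono) simp
  have j1: "1 \<le> j"
  proof (rule ccontr)
    assume "\<not> 1 \<le> j"
    then have "canonical_chain S p j = {}" by (cases j) auto
    then show False using sub neq mono by blast
  qed
  have not_sub: "\<not> least_max (of_int b - 1) \<subseteq> canonical_chain S p (j - 1)"
    using j1 unfolding j_def by (intro not_less_Least) simp
  let ?e = "essential_value S p j"
  have "b \<le> ?e"
  proof (rule ccontr)
    assume "\<not> b \<le> ?e"
    then have "(of_int ?e :: real) \<le> of_int b - 1" by linarith
    then show False
      using least_max_antimono not_sub essential_value(1)[OF j1 jq] by metis
  qed
  moreover have "\<not> b < ?e"
  proof
    assume "b < ?e"
    then have "(of_int b :: real) \<le> of_int ?e - 1" by linarith
    then have "canonical_chain S p j \<subseteq> least_max (of_int b)"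
      using least_max_antimono essential_value(2)[OF j1 jq] by metis
    then show False using sub neq mono by auto
  qed
  ultimately have "b = ?e" by simp
  then show "b \<in> essential_values S p"
    unfolding essential_values_def using j1 jq by auto
qed

section \<open>Comparison of the two partitions\<close>

lemma critical_indices_iff:
  "i \<in> critical_indices S p j \<longleftrightarrow> 1 \<le> i \<and> i \<le> num_critical S p \<and>
     critical_value S p i \<le> of_int (essential_value S p j) \<and>
     of_int (essential_value S p j) - 1 < critical_value S p i"
  unfolding critical_indices_def by (auto simp: ceiling_eq_iff)

text \<open>The point is that the index set is nonempty: each essential value has a critical value
  in its unit interval.\<close>

lemma Max_critical_indices:
  assumes "1 \<le> j" "j \<le> num_essential S p"
  shows "Max (critical_indices S p j) \<in> critical_indices S p j"
    and "i \<in> critical_indices S p j \<Longrightarrow> i \<le> Max (critical_indices S p j)"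
proof -
  have "essential_value S p j \<in> essential_values S p"
    using assms unfolding essential_values_def by auto
  then have "critical_indices S p j \<noteq> {}"
    unfolding mem_essential_values_iff least_max_neq_iff critical_values_eq
    by (auto simp: critical_indices_iff)
  moreover have "finite (critical_indices S p j)"
    unfolding critical_indices_def by simp
  ultimately show "Max (critical_indices S p j) \<in> critical_indices S p j"
    "i \<in> critical_indices S p j \<Longrightarrow> i \<le> Max (critical_indices S p j)"
    by auto
qed

text \<open>The largest index belongs to the smallest critical value above \<open>?e - 1\<close>. No
  critical value lies strictly between the two, so M at the former equals m at the latter, which is
  the canonical chain member.\<close>

lemma canonical_chain_eq_principal_chain:
  assumes "1 \<le> j" "j \<le> num_essential S p"
  shows "canonical_chain S p j = principal_chain S p (Max (critical_indices S p j))"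
proof -
  let ?m = "Max (critical_indices S p j)" and ?e = "essential_value S p j"
  have m: "1 \<le> ?m" "?m \<le> num_critical S p" "of_int ?e - 1 < critical_value S p ?m"
    "critical_value S p ?m \<le> of_int ?e"
    using Max_critical_indices(1)[OF assms] unfolding critical_indices_iff by auto
  have "greatest_max (critical_value S p ?m) = least_max (of_int ?e - 1)"
  proof (rule greatest_eq_least[OF m(3)])
    fix c assume "c \<in> critical_values S p" and c: "of_int ?e - 1 < c"
    then obtain i where i: "1 \<le> i" "i \<le> num_critical S p" "c = critical_value S p i"
      unfolding critical_values_eq by auto
    show "\<not> c < critical_value S p ?m"
    proof
      assume less: "c < critical_value S p ?m"
      then have "i \<in> critical_indices S p j"
        using i c m(4) unfolding critical_indices_iff by auto
      then have "i \<le> ?m" by (rule Max_critical_indices(2)[OF assms])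
      then show False
        using critical_value_le[of i ?m] i m(2) less by simp
    qed
  qed
  then show ?thesis
    using principal_chain_eq[OF m(1,2)] essential_value(2)[OF assms] by simp
qed

lemma canonical_part_eq_Union:
  assumes "1 \<le> j" "j \<le> num_essential S p"
  shows "canonical_part S p j = (\<Union>i\<in>critical_indices S p j. principal_part S p i)"
proof
  let ?m = "Max (critical_indices S p j)" and ?e = "essential_value S p j"
  note part = essential_value(3)[OF assms]
  show "(\<Union>i\<in>critical_indices S p j. principal_part S p i) \<subseteq> canonical_part S p j"
  proof (rule UN_least)
    fix i assume "i \<in> critical_indices S p j"
    then have "least_max (of_int ?e) \<subseteq> least_max (critical_value S p i)"
      "greatest_max (critical_value S p i) \<subseteq> least_max (of_int ?e - 1)"
      unfolding critical_indices_iff by (auto intro!: least_max_antimono greatest_le_least del: subsetI)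
    then show "principal_part S p i \<subseteq> canonical_part S p j"
      using essential_value(1,2)[OF assms] unfolding part principal_part_eq by blast
  qed
  show "canonical_part S p j \<subseteq> (\<Union>i\<in>critical_indices S p j. principal_part S p i)"
  proof
    fix x assume "x \<in> canonical_part S p j"
    then have x: "x \<in> principal_chain S p ?m" "x \<notin> least_max (of_int ?e)"
      using part canonical_chain_eq_principal_chain[OF assms] essential_value(1)[OF assms]
      by auto
    obtain i where i: "1 \<le> i" "i \<le> ?m" "x \<in> principal_part S p i"
      using x(1) unfolding principal_chain_def by auto
    have m: "?m \<le> num_critical S p" "of_int ?e - 1 < critical_value S p ?m"
      using Max_critical_indices(1)[OF assms] unfolding critical_indices_iff by auto
    \<comment> \<open>A principal part for a critical value above \<open>?e\<close> is already
      contained in m(?e), the previous canonical chain member, which does not contain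
      \<open>x\<close>.\<close>
    have "critical_value S p i \<le> of_int ?e"
    proof (rule ccontr)
      assume "\<not> ?thesis"
      then have "greatest_max (critical_value S p i) \<subseteq> least_max (of_int ?e)"
        by (intro greatest_le_least) simp
      then show False using i(3) x(2) unfolding principal_part_eq by auto
    qed
    moreover have "critical_value S p ?m \<le> critical_value S p i"
      using i m by (intro critical_value_le)
    ultimately have "i \<in> critical_indices S p j"
      using i m unfolding critical_indices_iff by auto
    then show "x \<in> (\<Union>i\<in>critical_indices S p j. principal_part S p i)"
      using i(3) by blast
  qed
qed

lemma essential_values_eq_ceilings:
  "essential_values S p = (\<lambda>i. \<lceil>critical_value S p i\<rceil>) ` {1..num_critical S p}"
proof (rule set_eqI)
  fix b
  show "b \<in> essential_values S p \<longleftrightarrow> b \<in> (\<lambda>i. \<lceil>critical_value S p i\<rceil>) ` {1..num_critical S p}"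
    unfolding mem_essential_values_iff least_max_neq_iff critical_values_eq image_iff
    by (auto simp: eq_commute[of b] ceiling_eq_iff)
qed

end

theorem theorem6p6:
  fixes S :: "'a set" and p :: "'a set \<Rightarrow> ereal"
  assumes "finite S" and "S \<noteq> {}"
    and "integer_valued_on S p" and "supermodular_on S p"
    and "p {} = 0" and "p S > -\<infinity>"
  shows
    "(\<forall>b::int. b \<in> essential_values S p \<longleftrightarrow>
        (\<exists>l\<in>critical_values S p. of_int b \<ge> l \<and> l > of_int b - 1))
     \<and>
     ((\<forall>j k. 1 \<le> j \<and> j < k \<and> k \<le> num_essential S p \<longrightarrow>
          essential_value S p j > essential_value S p k) \<and>
      (\<forall>i k. 1 \<le> i \<and> i < k \<and> k \<le> num_critical S p \<longrightarrow>
          \<lceil>critical_value S p i\<rceil> \<ge> \<lceil>critical_value S p k\<rceil>) \<and>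
      essential_value S p ` {1..num_essential S p} =
        (\<lambda>i. \<lceil>critical_value S p i\<rceil>) ` {1..num_critical S p})
     \<and>
     (\<forall>j\<in>{1..num_essential S p}.
        canonical_part S p j = (\<Union>i\<in>critical_indices S p j. principal_part S p i))
     \<and>
     ((\<forall>j\<in>{1..num_essential S p}.
        canonical_chain S p j = principal_chain S p (Max (critical_indices S p j))) \<and>
      canonical_chain S p ` {1..num_essential S p} \<subseteq>
        principal_chain S p ` {1..num_critical S p})"
proof -
  interpret integral_supermodular S p
    using assms by unfold_locales
  have chain: "\<forall>j\<in>{1..num_essential S p}.
      canonical_chain S p j = principal_chain S p (Max (critical_indices S p j))"
    using canonical_chain_eq_principal_chain by simp
  \<comment> \<open>Having this index in range turns the equality of chain members into the subchain
    statement.\<close>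
  moreover have "Max (critical_indices S p j) \<in> {1..num_critical S p}"
    if "j \<in> {1..num_essential S p}" for j
    using Max_critical_indices(1)[of j] that unfolding critical_indices_iff by simp
  ultimately have "canonical_chain S p ` {1..num_essential S p} \<subseteq>
      principal_chain S p ` {1..num_critical S p}"
    by blast
  moreover have "\<forall>i k. 1 \<le> i \<and> i < k \<and> k \<le> num_critical S p \<longrightarrow>
      \<lceil>critical_value S p i\<rceil> \<ge> \<lceil>critical_value S p k\<rceil>"
    using critical_value_less by (intro allI impI ceiling_mono less_imp_le) blast
  ultimately show ?thesis
    using chain essential_value_less canonical_part_eq_Union
      essential_values_eq_ceilings[unfolded essential_values_def]
    by (simp add: mem_essential_values_iff least_max_neq_iff)
qed

end
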